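(* Let $\mathcal{C}$ be a set of positive integers and let $\mathcal{P}$ be the class of graphs having no hole whose length belongs to $\mathcal{C}$. If $\mathcal{P}$ is expressible by forbidden orientations, then at least one of the following holds: (1) $\mathcal{C}$ is finite; (2) there is a positive integer $M$ such that $\mathcal{C}_M$ is the set of odd integers greater than or equal to $M$ (equivalently, $cyc(\mathcal{P})_M$ is the set of even integers greater than or equal to $M$).
   Context: Graphs are finite and simple; $C_k$ is the cycle with $k$ vertices. A hole is an induced cycle of length at least four. An oriented graph is a digraph without loops, parallel arcs or pairs of opposite arcs; an orientation assigns a direction to each edge. For a set $F$ of oriented graphs, an oriented graph is $F$-free if no member of $F$ is isomorphic to an induced subdigraph of it. A graph class $\mathcal{P}$ is expressible by forbidden orientations if there is a finite set $F$ of oriented graphs such that a graph belongs to $\mathcal{P}$ iff it admits an $F$-free orientation. $cyc(\mathcal{P})$ is the set of integers $k\ge3$ with $C_k\in\mathcal{P}$; for a set $B$ of integers, $B_M=\{b\in B:b\ge M\}$. *)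

theory Defs
  imports "Graph_Theory.Graph_Theory"
begin

text \<open>
  Finite simple graphs are symmetric loop-free pair digraphs (\<^locale>\<open>pair_graph\<close>). Graph classes
  are sets of graphs with vertices in \<^typ>\<open>nat\<close>, which represents every finite graph up to
  isomorphism.
\<close>

locale oriented_graph = pair_digraph +
  assumes no_opposite_arcs: "(u, v) \<in> parcs G \<Longrightarrow> (v, u) \<notin> parcs G"

definition orientation_of :: "'a pair_pre_digraph \<Rightarrow> 'a pair_pre_digraph \<Rightarrow> bool" where
  "orientation_of D G \<longleftrightarrow> oriented_graph D \<and> mk_symmetric (with_proj D) = G"

definition has_induced_copy :: "'a pair_pre_digraph \<Rightarrow> 'b pair_pre_digraph \<Rightarrow> bool" where
  "has_induced_copy G H \<longleftrightarrow>
     (\<exists>K. induced_subgraph (with_proj K) (with_proj G) \<and> digraph_iso (with_proj H) (with_proj K))"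

definition free_of :: "'b pair_pre_digraph set \<Rightarrow> 'a pair_pre_digraph \<Rightarrow> bool" where
  "free_of F D \<longleftrightarrow> (\<forall>H\<in>F. \<not> has_induced_copy D H)"

definition expressible_by_forbidden_orientations :: "nat pair_pre_digraph set \<Rightarrow> bool" where
  "expressible_by_forbidden_orientations P \<longleftrightarrow>
     (\<exists>F :: nat pair_pre_digraph set. finite F \<and> (\<forall>H\<in>F. oriented_graph H) \<and>
        (\<forall>G. pair_graph G \<longrightarrow> (G \<in> P \<longleftrightarrow> (\<exists>D. orientation_of D G \<and> free_of F D))))"

text \<open>Only meaningful for \<open>k \<ge> 3\<close>.\<close>
definition cycle_graph :: "nat \<Rightarrow> nat pair_pre_digraph" where
  "cycle_graph k =
     \<lparr> pverts = {..<k},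
       parcs = {(i, j). i < k \<and> j < k \<and> (j = (i + 1) mod k \<or> i = (j + 1) mod k)} \<rparr>"

definition has_hole :: "'a pair_pre_digraph \<Rightarrow> nat \<Rightarrow> bool" where
  "has_hole G k \<longleftrightarrow> k \<ge> 4 \<and> has_induced_copy G (cycle_graph k)"

definition graphs_without_holes :: "nat set \<Rightarrow> nat pair_pre_digraph set" where
  "graphs_without_holes C = {G. pair_graph G \<and> (\<forall>c\<in>C. \<not> has_hole G c)}"

definition cyc :: "nat pair_pre_digraph set \<Rightarrow> nat set" where
  "cyc P = {k. k \<ge> 3 \<and> cycle_graph k \<in> P}"

definition from_on :: "nat set \<Rightarrow> nat \<Rightarrow> nat set" where
  "from_on B M = {b \<in> B. b \<ge> M}"

end

theory Submission
  imports Defs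
begin

text \<open>
  Let \<open>N\<close> bound the number of vertices of the forbidden oriented graphs. An orientation of a cycle of
  length \<open>q > N\<close> is free of them as soon as all its stretches of \<open>N\<close> vertices occur as induced oriented
  paths, in sufficiently many disjoint copies, in some free oriented graph. Many identically oriented
  copies of a graph \<open>G\<close> of the class are obtained by pigeonhole from a free orientation of a large
  disjoint union of copies of \<open>G\<close>.

  For \<open>G\<close> a long path, a repeated stretch yields one cycle of length greater than \<open>N\<close> in the class.
  If \<open>k, k' > N\<close> are lengths of cycles in the class, let \<open>G\<close> consist of two such cycles joined by a path
  of arbitrary length. The closed walk around the first cycle, along the path, around the second cycle
  and back has length \<open>k + k' + 2 * l + 2\<close> and its short stretches are induced paths, so the cycles of
  all these lengths lie in the class. With \<open>k = k'\<close> this gives all large even lengths; with \<open>k\<close> even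
  and \<open>k'\<close> odd, a single large odd length gives all large odd lengths.
\<close>

section \<open>Induced copies and orientations\<close>

text \<open>Working form of \<open>has_induced_copy\<close>. Isomorphisms carry separate maps for
  arcs, tails and heads, but between pair digraphs the vertex map determines them all.\<close>

definition induced_embedding :: "('a \<Rightarrow> 'b) \<Rightarrow> 'a pair_pre_digraph \<Rightarrow> 'b pair_pre_digraph \<Rightarrow> bool" where
  "induced_embedding f H D \<longleftrightarrow> inj_on f (pverts H) \<and> f ` pverts H \<subseteq> pverts D \<and>
     (\<forall>u\<in>pverts H. \<forall>v\<in>pverts H. (u, v) \<in> parcs H \<longleftrightarrow> (f u, f v) \<in> parcs D)"

lemma has_induced_copyE:
  assumes "has_induced_copy D H"
  obtains f where "induced_embedding f H D"
proof -
  from assms obtain K h where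
    K: "induced_subgraph (with_proj K) (with_proj D)"
    and h: "pre_digraph.digraph_isomorphism (with_proj H) h" "with_proj K = app_iso h (with_proj H)"
    by (auto simp: has_induced_copy_def digraph_iso_def)
  let ?f = "iso_verts h"
  have wf: "wf_digraph (with_proj H)" and inj: "inj_on ?f (pverts H)"
    and ends: "\<And>u v. (u, v) \<in> parcs H \<Longrightarrow>
      ?f u = iso_tail h (iso_arcs h (u, v)) \<and> ?f v = iso_head h (iso_arcs h (u, v))"
    using h(1) by (force simp: pre_digraph.digraph_isomorphism_def)+
  have Kh: "pverts K = ?f ` pverts H" "parcs K = iso_arcs h ` parcs H"
    "fst = iso_tail h" "snd = iso_head h"
    using h(2) by (auto simp: app_iso_def with_proj_def)
  have KD: "pverts K \<subseteq> pverts D" "parcs K = {e \<in> parcs D. fst e \<in> pverts K \<and> snd e \<in> pverts K}"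
    using K by (auto simp: induced_subgraph_def subgraph_def)
  have arc: "iso_arcs h (u, v) = (?f u, ?f v)" if "(u, v) \<in> parcs H" for u v
    using ends[OF that] Kh(3,4) by (metis prod.collapse)
  have "(u, v) \<in> parcs H \<longleftrightarrow> (?f u, ?f v) \<in> parcs D" if "u \<in> pverts H" "v \<in> pverts H" for u v
  proof
    assume "(u, v) \<in> parcs H"
    then show "(?f u, ?f v) \<in> parcs D" using arc Kh(2) KD(2) by force
  next
    assume "(?f u, ?f v) \<in> parcs D"
    then have "(?f u, ?f v) \<in> iso_arcs h ` parcs H" using KD(2) Kh(1,2) that by force
    then obtain a b where ab: "(a, b) \<in> parcs H" "(?f u, ?f v) = (?f a, ?f b)"
      using arc by fastforce
    then have "a \<in> pverts H" "b \<in> pverts H"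
      using wf wf_digraph_wp_iff pair_wf_digraph.wellformed' by metis+
    then show "(u, v) \<in> parcs H" using ab inj that by (metis inj_onD prod.inject)
  qed
  then show ?thesis
    using that[of ?f] inj Kh(1) KD(1) by (simp add: induced_embedding_def)
qed

lemma has_induced_copyI:
  assumes "pair_wf_digraph H" "pair_wf_digraph D" "induced_embedding f H D"
  shows "has_induced_copy D H"
proof -
  have f: "inj_on f (pverts H)" "f ` pverts H \<subseteq> pverts D"
    and arc: "\<And>u v. u \<in> pverts H \<Longrightarrow> v \<in> pverts H \<Longrightarrow> (u, v) \<in> parcs H \<longleftrightarrow> (f u, f v) \<in> parcs D"
    using assms(3) by (auto simp: induced_embedding_def)
  have Hv: "u \<in> pverts H \<and> v \<in> pverts H" if "(u, v) \<in> parcs H" for u v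
    using pair_wf_digraph.wellformed'[OF assms(1) that] by simp
  define h where "h = \<lparr>iso_verts = f, iso_arcs = map_prod f f, iso_head = snd, iso_tail = fst\<rparr>"
  define K where "K = \<lparr>pverts = f ` pverts H, parcs = map_prod f f ` parcs H\<rparr>"
  have "inj_on (map_prod f f) (parcs H)"
    using f(1) Hv by (auto simp: inj_on_def)
  then have iso: "pre_digraph.digraph_isomorphism (with_proj H) h"
    using f(1) assms(1) by (auto simp: pre_digraph.digraph_isomorphism_def h_def wf_digraph_wp_iff)
  have K: "with_proj K = app_iso h (with_proj H)"
    by (simp add: with_proj_def app_iso_def K_def h_def)
  have wf: "pair_wf_digraph K"
    using Hv by (auto simp: K_def pair_wf_digraph_def)
  have "parcs K = {e \<in> parcs D. fst e \<in> pverts K \<and> snd e \<in> pverts K}"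
  proof (intro set_eqI iffI)
    fix e assume "e \<in> parcs K"
    then obtain u v where "(u, v) \<in> parcs H" "e = (f u, f v)" by (auto simp: K_def)
    then show "e \<in> {e \<in> parcs D. fst e \<in> pverts K \<and> snd e \<in> pverts K}"
      using arc[of u v] Hv[of u v] by (simp add: K_def)
  next
    fix e assume "e \<in> {e \<in> parcs D. fst e \<in> pverts K \<and> snd e \<in> pverts K}"
    then obtain u v where "u \<in> pverts H" "v \<in> pverts H" "e = (f u, f v)" "(f u, f v) \<in> parcs D"
      by (cases e) (auto simp: K_def)
    then show "e \<in> parcs K" using arc[of u v] by (force simp: K_def)
  qed
  moreover from this have "parcs K \<subseteq> parcs D" by blast
  moreover have "pverts K \<subseteq> pverts D" using f(2) by (simp add: K_def)
  ultimately have "induced_subgraph (with_proj K) (with_proj D)"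
    using wf assms(2)
    unfolding induced_subgraph_def subgraph_def compatible_def wf_digraph_wp_iff with_proj_simps by blast
  with iso K show ?thesis unfolding has_induced_copy_def digraph_iso_def by blast
qed

lemma in_parcs_mk_symmetric_iff:
  "(u, v) \<in> parcs (mk_symmetric (with_proj D)) \<longleftrightarrow> (u, v) \<in> parcs D \<or> (v, u) \<in> parcs D"
  unfolding parcs_mk_symmetric by (auto intro: bexI[of _ "(u, v)"] bexI[of _ "(v, u)"])

lemma orientation_ofD:
  assumes "orientation_of D G"
  shows "oriented_graph D" "pverts D = pverts G"
    "(u, v) \<in> parcs G \<longleftrightarrow> (u, v) \<in> parcs D \<or> (v, u) \<in> parcs D"
  using assms in_parcs_mk_symmetric_iff[of u v D] by (auto simp: orientation_of_def)

lemma oriented_graph_wf: "oriented_graph D \<Longrightarrow> pair_wf_digraph D"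
  by (simp add: oriented_graph_def pair_digraph_def pair_fin_digraph_def)

lemma pair_graph_wf: "pair_graph G \<Longrightarrow> pair_wf_digraph G"
  by (simp add: pair_graph_def pair_digraph_def pair_fin_digraph_def)

lemma pair_graphI:
  assumes "finite (pverts G)" "\<And>u v. (u, v) \<in> parcs G \<Longrightarrow> u \<in> pverts G \<and> v \<in> pverts G"
    "\<And>u v. (u, v) \<in> parcs G \<Longrightarrow> (v, u) \<in> parcs G" "\<And>u. (u, u) \<notin> parcs G"
  shows "pair_graph G"
proof -
  have "parcs G \<subseteq> pverts G \<times> pverts G" using assms(2) by auto
  then have "finite (parcs G)" using assms(1) by (meson finite_SigmaI finite_subset)
  with assms show ?thesis
    by unfold_locales (auto simp: symmetric_def intro: symI)
qed

lemma oriented_graphI: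
  assumes "finite (pverts D)" "\<And>u v. (u, v) \<in> parcs D \<Longrightarrow> u \<in> pverts D \<and> v \<in> pverts D"
    "\<And>u v. (u, v) \<in> parcs D \<Longrightarrow> (v, u) \<notin> parcs D"
  shows "oriented_graph D"
proof -
  have "parcs D \<subseteq> pverts D \<times> pverts D" using assms(2) by auto
  then have "finite (parcs D)" using assms(1) by (meson finite_SigmaI finite_subset)
  moreover have "\<And>u. (u, u) \<notin> parcs D" using assms(3) by blast
  ultimately show ?thesis
    using assms by unfold_locales auto
qed

section \<open>Cycles, their orientations and disjoint copies\<close>

lemma succ_mod: "i < q \<Longrightarrow> Suc i mod q = (if Suc i = q then 0 else Suc i)" for i q :: nat
  by (auto simp: mod_Suc)

lemma cycle_graph_arc_iff:
  "(i, j) \<in> parcs (cycle_graph k) \<longleftrightarrow> i < k \<and> j < k \<and> (j = (i + 1) mod k \<or> i = (j + 1) mod k)"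
  by (simp add: cycle_graph_def)

lemma pverts_cycle_graph [simp]: "pverts (cycle_graph k) = {..<k}"
  by (simp add: cycle_graph_def)

lemma pair_graph_cycle_graph: "k \<ge> 3 \<Longrightarrow> pair_graph (cycle_graph k)"
  by (rule pair_graphI) (auto simp: cycle_graph_arc_iff succ_mod split: if_splits)

text \<open>One bit per edge: \<open>w i\<close> tells whether the edge from \<open>i\<close> to its
  cyclic successor points forward. In this form directions can be read off a closed walk.\<close>

definition oriented_cycle :: "(nat \<Rightarrow> bool) \<Rightarrow> nat \<Rightarrow> nat pair_pre_digraph" where
  "oriented_cycle w q = \<lparr>pverts = {..<q}, parcs = {(i, j). i < q \<and> j < q \<and>
     (j = (i + 1) mod q \<and> w i \<or> i = (j + 1) mod q \<and> \<not> w j)}\<rparr>"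

lemma orientation_of_oriented_cycle:
  assumes "q \<ge> 3"
  shows "orientation_of (oriented_cycle w q) (cycle_graph q)"
proof -
  \<comment> \<open>This fails for \<open>q = 2\<close>, where each vertex succeeds the other and
    both directions could be prescribed.\<close>
  have no2: "\<not> (j = (i + 1) mod q \<and> i = (j + 1) mod q)" if "i < q" "j < q" for i j
    using assms that succ_mod[of i q] succ_mod[of j q] by (simp split: if_splits)
  have arc: "(i, j) \<in> parcs (oriented_cycle w q) \<longleftrightarrow> i < q \<and> j < q \<and>
      (j = (i + 1) mod q \<and> w i \<or> i = (j + 1) mod q \<and> \<not> w j)" for i j
    by (simp add: oriented_cycle_def)
  have "oriented_graph (oriented_cycle w q)"
  proof (rule oriented_graphI)
    show "(v, u) \<notin> parcs (oriented_cycle w q)" if "(u, v) \<in> parcs (oriented_cycle w q)" for u v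
      using that no2[of u v] unfolding arc by blast
  qed (auto simp: oriented_cycle_def)
  moreover have "mk_symmetric (with_proj (oriented_cycle w q)) = cycle_graph q"
  proof (rule pair_pre_digraph.equality)
    show "parcs (mk_symmetric (with_proj (oriented_cycle w q))) = parcs (cycle_graph q)"
      unfolding set_eq_iff split_paired_All in_parcs_mk_symmetric_iff arc cycle_graph_arc_iff by blast
  qed (auto simp: oriented_cycle_def)
  ultimately show ?thesis by (simp add: orientation_of_def)
qed

text \<open>Vertex \<open>j * n + u\<close> is the vertex \<open>u\<close> of the \<open>j\<close>-th copy.\<close>
definition copies :: "nat \<Rightarrow> nat \<Rightarrow> (nat \<Rightarrow> nat \<Rightarrow> bool) \<Rightarrow> nat pair_pre_digraph" where
  "copies m n E = \<lparr>pverts = {..<m * n},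
     parcs = {(x, y). x < m * n \<and> y < m * n \<and> x div n = y div n \<and> E (x mod n) (y mod n)}\<rparr>"

lemma pair_graph_copies:
  assumes "symp E" "irreflp E"
  shows "pair_graph (copies m n E)"
  using assms by (intro pair_graphI) (auto simp: copies_def irreflp_def dest: sympD)

definition path_adj :: "nat \<Rightarrow> nat \<Rightarrow> bool" where
  "path_adj u v \<longleftrightarrow> v = u + 1 \<or> u = v + 1"

section \<open>Cycle orientations from local windows\<close>

text \<open>\<open>\<Theta> r\<close> embeds the stretch of \<open>N\<close> vertices of the cycle starting at \<open>r\<close>. A forbidden graph
  misses a vertex of the cycle, so it consists of runs of consecutive vertices; each run is moved to the
  stretch that starts where the run starts, which keeps different runs apart.\<close>
lemma free_of_oriented_cycle:
  fixes \<Theta> :: "nat \<Rightarrow> nat \<Rightarrow> 'a"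
  assumes D: "oriented_graph D" "free_of F D"
    and F: "\<And>H. H \<in> F \<Longrightarrow> oriented_graph H \<and> card (pverts H) \<le> N"
    and q: "N < q"
    and verts: "\<And>r s. r < q \<Longrightarrow> s < N \<Longrightarrow> \<Theta> r s \<in> pverts D"
    and inj: "\<And>r s r' s'. \<lbrakk>r < q; s < N; r' < q; s' < N; \<Theta> r s = \<Theta> r' s'\<rbrakk> \<Longrightarrow> r = r' \<and> s = s'"
    and arcs: "\<And>r s r' s'. \<lbrakk>r < q; s < N; r' < q; s' < N\<rbrakk> \<Longrightarrow> (\<Theta> r s, \<Theta> r' s') \<in> parcs D \<longleftrightarrow>
      r = r' \<and> (s' = s + 1 \<and> w ((r + s) mod q) \<or> s = s' + 1 \<and> \<not> w ((r + s') mod q))"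
  shows "free_of F (oriented_cycle w q)"
  unfolding free_of_def
proof (intro ballI notI)
  fix H assume "H \<in> F" "has_induced_copy (oriented_cycle w q) H"
  then obtain f where "induced_embedding f H (oriented_cycle w q)"
    and H: "oriented_graph H" "card (pverts H) \<le> N"
    using F has_induced_copyE by blast
  then have f: "inj_on f (pverts H)" "\<And>h. h \<in> pverts H \<Longrightarrow> f h < q"
    and f_arc: "\<And>u v. u \<in> pverts H \<Longrightarrow> v \<in> pverts H \<Longrightarrow>
      (u, v) \<in> parcs H \<longleftrightarrow> (f u, f v) \<in> parcs (oriented_cycle w q)"
    by (auto simp: induced_embedding_def oriented_cycle_def)
  have fin: "finite (pverts H)"
    using H(1) by (simp add: oriented_graph_def pair_digraph_def pair_fin_digraph_def
        pair_fin_digraph_axioms_def)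
  have "card (f ` pverts H) < card {..<q}" using card_image_le[OF fin, of f] H(2) q by simp
  then obtain z where z: "z < q" "z \<notin> f ` pverts H"
    by (metis card_mono finite_imageI fin lessThan_iff not_le subsetI)
  \<comment> \<open>Coordinates on the cycle that start right after the unused vertex \<open>z\<close>.\<close>
  define c where "c p = (z + 1 + p) mod q" for p
  have c_if: "c p = (if z + 1 + p < q then z + 1 + p else z + 1 + p - q)" if "p < q" for p
    using that z(1) by (auto simp: c_def le_mod_geq)
  have c_less: "c p < q" for p using q by (simp add: c_def)
  have c_inj: "p = p'" if "c p = c p'" "p < q" "p' < q" for p p'
    using that z(1) by (auto simp: c_if split: if_splits)
  \<comment> \<open>Coordinate \<open>q - 1\<close> belongs to \<open>z\<close>, so used vertices
    stay below it and no adjacency between them wraps around.\<close>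
  have "\<exists>p<q - 1. c p = f h" if "h \<in> pverts H" for h
  proof -
    have "f h \<noteq> z" "f h < q" using z(2) f(2) that by auto
    then show ?thesis
      using z(1) by (cases "z < f h")
        (force intro!: exI[of _ "f h - z - 1"] simp: c_if, force intro!: exI[of _ "f h + q - z - 1"] simp: c_if)
  qed
  then obtain g where g: "\<And>h. h \<in> pverts H \<Longrightarrow> g h < q - 1 \<and> c (g h) = f h" by metis
  define S where "S = g ` pverts H"
  \<comment> \<open>For \<open>p\<close> in \<open>S\<close>, this is the first coordinate of the
    run of used coordinates containing \<open>p\<close>.\<close>
  define R where "R p = (LEAST x. {x..p} \<subseteq> S)" for p
  have finS: "finite S" and cardS: "card S \<le> N"
    using fin H(2) card_image_le[OF fin, of g] by (auto simp: S_def)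
  have Rsub: "{R p..p} \<subseteq> S" and Rle: "R p \<le> p" if "p \<in> S" for p
    using LeastI[of "\<lambda>x. {x..p} \<subseteq> S" p] Least_le[of "\<lambda>x. {x..p} \<subseteq> S" p] that
    by (auto simp: R_def)
  have RN: "p - R p < N" if "p \<in> S" for p
    using card_mono[OF finS Rsub[OF that]] Rle[OF that] cardS by simp
  have Rsuc: "R (p + 1) = R p" if "p \<in> S" "p + 1 \<in> S" for p
  proof (rule antisym)
    have "{R p..p + 1} \<subseteq> S" using Rsub[OF that(1)] that(2) by (auto simp: le_Suc_eq)
    then show "R (p + 1) \<le> R p" unfolding R_def[of "p + 1"] by (rule Least_le)
    have "{R (p + 1)..p} \<subseteq> S" using Rsub[OF that(2)] by auto
    then show "R p \<le> R (p + 1)" unfolding R_def[of p] by (rule Least_le)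
  qed
  \<comment> \<open>Offset \<open>p - R p\<close> in the stretch starting at \<open>c (R p)\<close>
    stands for the vertex \<open>c p\<close>, so \<open>arcs\<close> consults the same bit of
    \<open>w\<close> as the cycle does.\<close>
  have cR: "(c (R p) + (p - R p)) mod q = c p" if "p \<in> S" for p
  proof -
    have "(c (R p) + (p - R p)) mod q = (z + 1 + R p + (p - R p)) mod q"
      unfolding c_def by (rule mod_add_left_eq)
    then show ?thesis using Rle[OF that] by (simp add: c_def)
  qed
  have c_suc: "(c p + 1) mod q = c (p + 1)" for p
    by (simp add: c_def mod_Suc_eq)
  have cyc_arc: "(c p, c p') \<in> parcs (oriented_cycle w q) \<longleftrightarrow>
      p' = p + 1 \<and> w (c p) \<or> p = p' + 1 \<and> \<not> w (c p')" if "p < q - 1" "p' < q - 1" for p p'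
  proof -
    have "c p' = (c p + 1) mod q \<longleftrightarrow> p' = p + 1" "c p = (c p' + 1) mod q \<longleftrightarrow> p = p' + 1"
      unfolding c_suc using c_inj[of p' "p + 1"] c_inj[of p "p' + 1"] that by auto
    then show ?thesis using c_less by (simp add: oriented_cycle_def)
  qed
  define e where "e h = \<Theta> (c (R (g h))) (g h - R (g h))" for h
  have gS: "g h \<in> S" if "h \<in> pverts H" for h using that by (simp add: S_def)
  have "induced_embedding e H D"
    unfolding induced_embedding_def
  proof (intro conjI ballI)
    show "inj_on e (pverts H)"
    proof (rule inj_onI)
      fix h h' assume hh: "h \<in> pverts H" "h' \<in> pverts H" "e h = e h'"
      then have "c (R (g h)) = c (R (g h')) \<and> g h - R (g h) = g h' - R (g h')"
        unfolding e_def using inj c_less RN gS by blast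
      moreover have "R (g h) < q" "R (g h') < q" using Rle[OF gS[OF hh(1)]] Rle[OF gS[OF hh(2)]] g hh
        by (meson diff_le_self le_less_trans less_le_trans)+
      ultimately have "R (g h) = R (g h')" "g h - R (g h) = g h' - R (g h')" using c_inj by blast+
      then have "g h = g h'" using Rle[OF gS[OF hh(1)]] Rle[OF gS[OF hh(2)]] by simp
      then show "h = h'" using g hh f(1) by (metis inj_onD)
    qed
    show "e ` pverts H \<subseteq> pverts D" using verts c_less RN gS by (auto simp: e_def)
    fix h h' assume hh: "h \<in> pverts H" "h' \<in> pverts H"
    let ?p = "g h" and ?p' = "g h'"
    have pS: "?p \<in> S" "?p' \<in> S" using gS hh by auto
    have lt: "?p < q - 1" "?p' < q - 1" using g hh by auto
    have Req: "R ?p = R ?p'" if "c (R ?p) = c (R ?p')"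
      using that c_inj Rle[OF pS(1)] Rle[OF pS(2)] lt by (metis diff_le_self le_less_trans less_le_trans)
    have "(e h, e h') \<in> parcs D \<longleftrightarrow> c (R ?p) = c (R ?p') \<and>
        (?p' - R ?p' = ?p - R ?p + 1 \<and> w (c ?p) \<or> ?p - R ?p = ?p' - R ?p' + 1 \<and> \<not> w (c ?p'))"
      unfolding e_def using arcs[OF c_less RN[OF pS(1)] c_less RN[OF pS(2)]] cR[OF pS(1)] cR[OF pS(2)]
      by metis
    \<comment> \<open>Neighbouring used coordinates share a run by \<open>Rsuc\<close>; within one
      run, offsets differ exactly as coordinates do.\<close>
    also have "\<dots> \<longleftrightarrow> ?p' = ?p + 1 \<and> w (c ?p) \<or> ?p = ?p' + 1 \<and> \<not> w (c ?p')"
      using Req Rsuc[of ?p] Rsuc[of ?p'] pS Rle[OF pS(1)] Rle[OF pS(2)] by auto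
    also have "\<dots> \<longleftrightarrow> (f h, f h') \<in> parcs (oriented_cycle w q)"
      using cyc_arc[OF lt] g hh by simp
    finally show "(h, h') \<in> parcs H \<longleftrightarrow> (e h, e h') \<in> parcs D" using f_arc[OF hh] by simp
  qed
  then have "has_induced_copy D H"
    by (rule has_induced_copyI[OF oriented_graph_wf[OF H(1)] oriented_graph_wf[OF D(1)]])
  then show False using D(2) \<open>H \<in> F\<close> by (simp add: free_of_def)
qed

section \<open>Pigeonhole over disjoint copies\<close>

lemma large_fibre:
  assumes "finite B" "f ` A \<subseteq> B" "card B * q < card A"
  shows "\<exists>b\<in>B. q < card {a \<in> A. f a = b}"
proof (rule ccontr)
  assume small: "\<not> (\<exists>b\<in>B. q < card {a \<in> A. f a = b})"
  have "A = (\<Union>b\<in>B. {a \<in> A. f a = b})" using assms(2) by auto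
  then have "card A \<le> (\<Sum>b\<in>B. card {a \<in> A. f a = b})"
    using card_UN_le[OF assms(1), of "\<lambda>b. {a \<in> A. f a = b}"] by simp
  also have "\<dots> \<le> card B * q"
    using sum_bounded_above[of B "\<lambda>b. card {a \<in> A. f a = b}" q] small by (simp add: not_less)
  finally show False using assms(3) by simp
qed

text \<open>A free orientation gives every copy one of finitely many arc sets. Among enough copies
  one arc set \<open>A\<close> occurs more than \<open>q\<close> times; \<open>\<rho> j\<close> maps
  into the \<open>j\<close>-th copy selected. Arcs between different copies are absent already in
  the underlying graph.\<close>

lemma identically_oriented_copies:
  fixes n q :: nat
  assumes "n > 0" "q > 0"
    and orient: "\<And>m. \<exists>D. orientation_of D (copies m n E) \<and> free_of F D"
  obtains D :: "nat pair_pre_digraph" and A \<rho> where "oriented_graph D" "free_of F D"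
    "\<And>j u. j < q \<Longrightarrow> u < n \<Longrightarrow> \<rho> j u \<in> pverts D"
    "\<And>j u j' u'. \<lbrakk>j < q; u < n; j' < q; u' < n; \<rho> j u = \<rho> j' u'\<rbrakk> \<Longrightarrow> j = j' \<and> u = u'"
    "\<And>j u j' u'. \<lbrakk>j < q; u < n; j' < q; u' < n\<rbrakk> \<Longrightarrow>
       (\<rho> j u, \<rho> j' u') \<in> parcs D \<longleftrightarrow> j = j' \<and> A u u'"
    "\<And>u v. \<lbrakk>u < n; v < n\<rbrakk> \<Longrightarrow> E u v \<longleftrightarrow> A u v \<or> A v u"
    "\<And>u v. \<lbrakk>u < n; v < n\<rbrakk> \<Longrightarrow> A u v \<Longrightarrow> \<not> A v u"
proof -
  \<comment> \<open>All conceivable arc sets of a single copy; \<open>m\<close> is chosen to exceed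
    \<open>q\<close> copies for each of them.\<close>
  define B where "B = Pow ({..<n} \<times> {..<n})"
  define m where "m = card B * q + 1"
  obtain D where D: "orientation_of D (copies m n E)" "free_of F D" using orient by blast
  note oD = orientation_ofD[OF D(1)]
  define T where "T j = {(u, v). u < n \<and> v < n \<and> (j * n + u, j * n + v) \<in> parcs D}" for j
  have "finite B" by (simp add: B_def)
  moreover have "T ` {..<m} \<subseteq> B" by (auto simp: B_def T_def)
  moreover have "card B * q < card {..<m}" by (simp add: m_def)
  ultimately have "\<exists>t\<in>B. q < card {j \<in> {..<m}. T j = t}" by (rule large_fibre)
  then obtain t where t: "q < card {j \<in> {..<m}. T j = t}" by blast
  let ?J = "{j \<in> {..<m}. T j = t}"
  obtain h where h: "bij_betw h {0..<card ?J} ?J" using ex_bij_betw_nat_finite[of ?J] by auto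
  have hJ: "h j < m" "T (h j) = t" if "j < q" for j
    using bij_betwE[OF h] that t by auto
  have h_inj: "j = j'" if "h j = h j'" "j < q" "j' < q" for j j'
    using h that t by (auto simp: bij_betw_def dest: inj_onD)
  define \<rho> where "\<rho> j u = h j * n + u" for j u
  define A where "A u v \<longleftrightarrow> (u, v) \<in> t" for u v
  have dm: "\<rho> j u div n = h j" "\<rho> j u mod n = u" if "u < n" for j u
    using that by (auto simp: \<rho>_def)
  have less: "\<rho> j u < m * n" if "j < q" "u < n" for j u
  proof -
    have "h j * n + u < (h j + 1) * n" using that by simp
    also have "\<dots> \<le> m * n" using hJ(1)[OF that(1)] by (intro mult_right_mono) auto
    finally show ?thesis by (simp add: \<rho>_def)
  qed
  have G: "(\<rho> j u, \<rho> j' v) \<in> parcs (copies m n E) \<longleftrightarrow> h j = h j' \<and> E u v"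
    if "j < q" "u < n" "j' < q" "v < n" for j u j' v
    using less dm that by (simp add: copies_def)
  have same: "(\<rho> j u, \<rho> j v) \<in> parcs D \<longleftrightarrow> A u v" if "j < q" "u < n" "v < n" for j u v
  proof -
    have "A u v \<longleftrightarrow> (u, v) \<in> T (h j)" using hJ(2)[OF that(1)] by (simp add: A_def)
    then show ?thesis using that by (simp add: T_def \<rho>_def)
  qed
  show thesis
  proof (rule that[of D \<rho> A])
    show "oriented_graph D" "free_of F D" using oD D by auto
    show "\<rho> j u \<in> pverts D" if "j < q" "u < n" for j u
      using less[OF that] oD(2) by (simp add: copies_def)
    show "j = j' \<and> u = u'" if "j < q" "u < n" "j' < q" "u' < n" "\<rho> j u = \<rho> j' u'" for j u j' u'
      using dm that h_inj by metis
    show "(\<rho> j u, \<rho> j' u') \<in> parcs D \<longleftrightarrow> j = j' \<and> A u u'"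
      if "j < q" "u < n" "j' < q" "u' < n" for j u j' u'
      using same[of j u u'] G[OF that] oD(3)[of "\<rho> j u" "\<rho> j' u'"] that h_inj by blast
    show "E u v \<longleftrightarrow> A u v \<or> A v u" if "u < n" "v < n" for u v
      using G[of 0 u 0 v] oD(3)[of "\<rho> 0 u" "\<rho> 0 v"] same[of 0] that assms(2) by blast
    show "\<not> A v u" if "u < n" "v < n" "A u v" for u v
      using oriented_graph.no_opposite_arcs[OF oD(1)] same[of 0] that assms(2) by blast
  qed
qed

text \<open>Window \<open>r\<close> is placed in a copy of its own, so windows may overlap inside
  the graph and \<open>Q\<close> copies suffice. The pattern \<open>A\<close> is known only after
  the pigeonhole, hence \<open>windows\<close> treats every \<open>A\<close> and lets the length
  \<open>q\<close> depend on it; \<open>P\<close> records what is guaranteed about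
  \<open>q\<close>.\<close>

lemma cycle_orientation_from_windows:
  fixes n N Q :: nat
  assumes pos: "n > 0" "Q > 0"
    and F: "\<And>H. H \<in> F \<Longrightarrow> oriented_graph H \<and> card (pverts H) \<le> N"
    and orient: "\<And>m. \<exists>D. orientation_of D (copies m n E) \<and> free_of F D"
    and windows: "\<And>A. \<exists>q w \<psi>. P q \<and> N < q \<and> 3 \<le> q \<and> q \<le> Q \<and>
       (\<forall>r<q. \<forall>s<N. \<psi> r s < n \<and>
          (\<forall>s'<N. (\<psi> r s = \<psi> r s' \<longrightarrow> s = s') \<and>
             (E (\<psi> r s) (\<psi> r s') \<longleftrightarrow> s' = s + 1 \<or> s = s' + 1)) \<and>
          (s + 1 < N \<longrightarrow> (A (\<psi> r s) (\<psi> r (s + 1)) \<longleftrightarrow> w ((r + s) mod q))))"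
  shows "\<exists>q. P q \<and> N < q \<and> 3 \<le> q \<and> (\<exists>D. orientation_of D (cycle_graph q) \<and> free_of F D)"
proof -
  obtain D :: "nat pair_pre_digraph" and A \<rho> where D: "oriented_graph D" "free_of F D"
    and \<rho>: "\<And>j u. j < Q \<Longrightarrow> u < n \<Longrightarrow> \<rho> j u \<in> pverts D"
    "\<And>j u j' u'. \<lbrakk>j < Q; u < n; j' < Q; u' < n; \<rho> j u = \<rho> j' u'\<rbrakk> \<Longrightarrow> j = j' \<and> u = u'"
    "\<And>j u j' u'. \<lbrakk>j < Q; u < n; j' < Q; u' < n\<rbrakk> \<Longrightarrow>
       (\<rho> j u, \<rho> j' u') \<in> parcs D \<longleftrightarrow> j = j' \<and> A u u'"
    and A: "\<And>u v. \<lbrakk>u < n; v < n\<rbrakk> \<Longrightarrow> E u v \<longleftrightarrow> A u v \<or> A v u"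
    "\<And>u v. \<lbrakk>u < n; v < n\<rbrakk> \<Longrightarrow> A u v \<Longrightarrow> \<not> A v u"
    by (rule identically_oriented_copies[OF pos orient]) blast
  obtain q w \<psi> where q: "P q" "N < q" "3 \<le> q" "q \<le> Q"
    and "\<forall>r<q. \<forall>s<N. \<psi> r s < n \<and>
          (\<forall>s'<N. (\<psi> r s = \<psi> r s' \<longrightarrow> s = s') \<and>
             (E (\<psi> r s) (\<psi> r s') \<longleftrightarrow> s' = s + 1 \<or> s = s' + 1)) \<and>
          (s + 1 < N \<longrightarrow> (A (\<psi> r s) (\<psi> r (s + 1)) \<longleftrightarrow> w ((r + s) mod q)))"
    using windows[of A] by blast
  then have \<psi>: "\<And>r s. \<lbrakk>r < q; s < N\<rbrakk> \<Longrightarrow> \<psi> r s < n"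
    "\<And>r s s'. \<lbrakk>r < q; s < N; s' < N; \<psi> r s = \<psi> r s'\<rbrakk> \<Longrightarrow> s = s'"
    "\<And>r s s'. \<lbrakk>r < q; s < N; s' < N\<rbrakk> \<Longrightarrow> E (\<psi> r s) (\<psi> r s') \<longleftrightarrow> s' = s + 1 \<or> s = s' + 1"
    "\<And>r s. \<lbrakk>r < q; s + 1 < N\<rbrakk> \<Longrightarrow> A (\<psi> r s) (\<psi> r (s + 1)) \<longleftrightarrow> w ((r + s) mod q)"
    by (metis add_lessD1)+
  \<comment> \<open>The windows prescribe forward arcs only. Backward arcs follow because
    \<open>A\<close> directs each edge of \<open>E\<close> in exactly one way.\<close>
  have A\<psi>: "A (\<psi> r s) (\<psi> r s') \<longleftrightarrow>
      s' = s + 1 \<and> w ((r + s) mod q) \<or> s = s' + 1 \<and> \<not> w ((r + s') mod q)"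
    if "r < q" "s < N" "s' < N" for r s s'
  proof -
    have lt: "\<psi> r s < n" "\<psi> r s' < n" using \<psi>(1) that by auto
    consider "s' = s + 1" | "s = s' + 1" | "s' \<noteq> s + 1" "s \<noteq> s' + 1" by blast
    then show ?thesis
    proof cases
      case 1
      then show ?thesis using \<psi>(4)[of r s] that by simp
    next
      case 2
      have "A (\<psi> r s) (\<psi> r s') \<longleftrightarrow> \<not> A (\<psi> r s') (\<psi> r s)"
        using 2 \<psi>(3)[OF that] A(1)[OF lt] A(2)[OF lt] A(2)[OF lt(2,1)] by blast
      then show ?thesis using 2 \<psi>(4)[of r s'] that by simp
    next
      case 3
      then show ?thesis using \<psi>(3)[OF that] A(1)[OF lt] by simp
    qed
  qed
  have "free_of F (oriented_cycle w q)"
  proof (rule free_of_oriented_cycle[where \<Theta> = "\<lambda>r s. \<rho> r (\<psi> r s)", OF D F q(2)])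
    show "\<rho> r (\<psi> r s) \<in> pverts D" if "r < q" "s < N" for r s
      using \<rho>(1)[of r "\<psi> r s"] \<psi>(1) that q(4) by simp
    show "r = r' \<and> s = s'" if "r < q" "s < N" "r' < q" "s' < N" "\<rho> r (\<psi> r s) = \<rho> r' (\<psi> r' s')" for r s r' s'
      using \<rho>(2)[of r "\<psi> r s" r' "\<psi> r' s'"] \<psi>(1,2) that q(4) by force
    show "(\<rho> r (\<psi> r s), \<rho> r' (\<psi> r' s')) \<in> parcs D \<longleftrightarrow>
      r = r' \<and> (s' = s + 1 \<and> w ((r + s) mod q) \<or> s = s' + 1 \<and> \<not> w ((r + s') mod q))"
      if "r < q" "s < N" "r' < q" "s' < N" for r s r' s'
      using \<rho>(3)[of r "\<psi> r s" r' "\<psi> r' s'"] \<psi>(1) A\<psi>[of r s s'] that q(4) by auto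
  qed
  then show ?thesis using q orientation_of_oriented_cycle by blast
qed

text \<open>Among \<open>2 ^ N + 1\<close> blocks of \<open>N\<close> edges on a long path two are
  oriented alike. Identifying them closes the stretch in between to a cycle whose windows are all
  stretches of the path.\<close>

lemma large_cycle_orientation:
  fixes N :: nat
  assumes F: "\<And>H. H \<in> F \<Longrightarrow> oriented_graph H \<and> card (pverts H) \<le> N"
    and orient: "\<And>n m. \<exists>D. orientation_of D (copies m n path_adj) \<and> free_of F D"
  shows "\<exists>q. N < q \<and> 3 \<le> q \<and> (\<exists>D. orientation_of D (cycle_graph q) \<and> free_of F D)"
proof -
  \<comment> \<open>Block starts are \<open>K\<close> apart, which makes the distance
    \<open>q\<close> of two blocks exceed \<open>N\<close> and be at least 3.\<close>
  define K where "K = N + 3"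
  define n where "n = 2 ^ N * K + N + 2"
  have "\<exists>q w \<psi>. True \<and> N < q \<and> 3 \<le> q \<and> q \<le> n \<and>
       (\<forall>r<q. \<forall>s<N. \<psi> r s < n \<and>
          (\<forall>s'<N. (\<psi> r s = \<psi> r s' \<longrightarrow> s = s') \<and>
             (path_adj (\<psi> r s) (\<psi> r s') \<longleftrightarrow> s' = s + 1 \<or> s = s' + 1)) \<and>
          (s + 1 < N \<longrightarrow> (A (\<psi> r s) (\<psi> r (s + 1)) \<longleftrightarrow> w ((r + s) mod q))))" for A :: "nat \<Rightarrow> nat \<Rightarrow> bool"
  proof -
    define W where "W i = {t. t < N \<and> A (i * K + t) (i * K + t + 1)}" for i
    have "W ` {..2 ^ N} \<subseteq> Pow {..<N}" by (auto simp: W_def)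
    then have "card (W ` {..2 ^ N}) \<le> 2 ^ N"
      using card_mono[of "Pow {..<N}"] by (simp add: card_Pow)
    then have "\<not> inj_on W {..2 ^ N}" using pigeonhole[of W "{..2 ^ N}"] by simp
    then obtain i i' where ii: "i < i'" "i' \<le> 2 ^ N" "W i = W i'"
      unfolding inj_on_def by (metis atMost_iff linorder_neqE_nat)
    define a b q where "a = i * K" and "b = i' * K" and "q = b - a"
    have "a + K = (i + 1) * K" by (simp add: a_def)
    also have "\<dots> \<le> b" unfolding b_def using ii(1) by (intro mult_right_mono) auto
    finally have ab: "a + K \<le> b" .
    have bn: "b + N + 2 \<le> n" unfolding b_def n_def using ii(2) by simp
    have rep: "A (a + t) (a + t + 1) \<longleftrightarrow> A (b + t) (b + t + 1)" if "t < N" for t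
    proof -
      have "t \<in> W i \<longleftrightarrow> t \<in> W i'" using ii(3) by simp
      then show ?thesis using that by (simp add: W_def a_def b_def)
    qed
    have qb: "b = a + q" and qN: "N + 3 \<le> q" using ab by (auto simp: q_def K_def)
    \<comment> \<open>A window overshoots \<open>b\<close> by fewer than \<open>N\<close> edges, and
      there the path repeats the directions found after \<open>a\<close>.\<close>
    have "A (a + r + s) (a + r + s + 1) \<longleftrightarrow> A (a + (r + s) mod q) (a + (r + s) mod q + 1)"
      if "r < q" "s < N" for r s
    proof (cases "r + s < q")
      case False
      then obtain t where t: "r + s = q + t" using le_Suc_ex not_less by blast
      then have "t < N" using that by simp
      then show ?thesis using t rep[of t] qN by (simp add: qb add.assoc[symmetric]) (simp add: add.assoc)
    qed (simp add: add.assoc)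
    then show ?thesis
      using qN qb bn
      by (intro exI[of _ q] exI[of _ "\<lambda>t. A (a + t) (a + t + 1)"] exI[of _ "\<lambda>r s. a + r + s"])
        (auto simp: path_adj_def)
  qed
  from cycle_orientation_from_windows[OF _ _ F orient[where n = n], of n "\<lambda>_. True", OF _ _ _ this]
  show ?thesis by (simp add: n_def)
qed

section \<open>Induced cycles\<close>

lemma succ_closed_subset:
  fixes k :: nat
  assumes "x < k" "x \<in> T" "\<And>y. y \<in> T \<Longrightarrow> y < k \<Longrightarrow> (y + 1) mod k \<in> T"
  shows "{..<k} \<subseteq> T"
proof
  have step: "(x + j) mod k \<in> T" for j
  proof (induction j)
    case (Suc j)
    then show ?case using assms(3)[of "(x + j) mod k"] assms(1) by (simp add: mod_Suc_eq)
  qed (use assms in simp)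
  fix y assume "y \<in> {..<k}"
  then show "y \<in> T" using step[of "y + k - x"] assms(1) by simp
qed

text \<open>For symmetric irreflexive \<open>E\<close>: finite, connected and 2-regular, which
  characterises cycles without a cyclic enumeration. Connectedness is stated through sets closed
  under adjacency.\<close>

definition induces_cycle :: "('a \<Rightarrow> 'a \<Rightarrow> bool) \<Rightarrow> 'a set \<Rightarrow> bool" where
  "induces_cycle E S \<longleftrightarrow> finite S \<and> S \<noteq> {} \<and>
     (\<forall>x\<in>S. \<exists>y\<in>S. \<exists>y'\<in>S. y \<noteq> y' \<and> (\<forall>z\<in>S. E x z \<longleftrightarrow> z = y \<or> z = y')) \<and>
     (\<forall>T. T \<inter> S \<noteq> {} \<longrightarrow> (\<forall>x\<in>T \<inter> S. \<forall>y\<in>S. E x y \<longrightarrow> y \<in> T) \<longrightarrow> S \<subseteq> T)"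

lemma induces_cycle_nbrs:
  assumes "induces_cycle E S" "x \<in> S"
  obtains y y' where "y \<in> S" "y' \<in> S" "y \<noteq> y'" "\<And>z. z \<in> S \<Longrightarrow> E x z \<longleftrightarrow> z = y \<or> z = y'"
  using assms unfolding induces_cycle_def by metis

lemma induces_cycle_connected:
  assumes "induces_cycle E S" "t \<in> T" "t \<in> S" "\<And>x y. x \<in> T \<Longrightarrow> x \<in> S \<Longrightarrow> y \<in> S \<Longrightarrow> E x y \<Longrightarrow> y \<in> T"
  shows "S \<subseteq> T"
  using assms unfolding induces_cycle_def by blast

lemma induces_cycle_cycle_graph:
  assumes "c \<ge> 3"
  shows "induces_cycle (\<lambda>i j. (i, j) \<in> parcs (cycle_graph c)) {..<c}"
  unfolding induces_cycle_def
proof (intro conjI ballI allI impI)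
  fix i assume i: "i \<in> {..<c}"
  define p where "p = (if i = 0 then c - 1 else i - 1)"
  have "(i + 1) mod c \<in> {..<c}" "p \<in> {..<c}" "(i + 1) mod c \<noteq> p"
    using i assms succ_mod[of i c] by (auto simp: p_def split: if_splits)
  moreover have "i = (z + 1) mod c \<longleftrightarrow> z = p" if "z < c" for z
    using that i succ_mod[of z c] by (auto simp: p_def split: if_splits)
  ultimately show "\<exists>y\<in>{..<c}. \<exists>y'\<in>{..<c}. y \<noteq> y' \<and>
      (\<forall>z\<in>{..<c}. (i, z) \<in> parcs (cycle_graph c) \<longleftrightarrow> z = y \<or> z = y')"
    using i by (intro bexI[of _ "(i + 1) mod c"] bexI[of _ p]) (auto simp: cycle_graph_arc_iff)
next
  fix T assume "T \<inter> {..<c} \<noteq> {}"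
    and T: "\<forall>x\<in>T \<inter> {..<c}. \<forall>y\<in>{..<c}. (x, y) \<in> parcs (cycle_graph c) \<longrightarrow> y \<in> T"
  then obtain x where "x < c" "x \<in> T" by blast
  then show "{..<c} \<subseteq> T"
  proof (rule succ_closed_subset)
    fix y assume y: "y \<in> T" "y < c"
    then have "(y, (y + 1) mod c) \<in> parcs (cycle_graph c)" by (simp add: cycle_graph_arc_iff)
    moreover have "(y + 1) mod c < c" using y by simp
    ultimately show "(y + 1) mod c \<in> T" using T y by blast
  qed
qed (use assms in \<open>auto simp: lessThan_empty_iff\<close>)

lemma induces_cycle_image:
  assumes "induces_cycle E S" "inj_on f S"
    and E: "\<And>x y. x \<in> S \<Longrightarrow> y \<in> S \<Longrightarrow> E x y \<longleftrightarrow> E' (f x) (f y)"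
  shows "induces_cycle E' (f ` S)"
  unfolding induces_cycle_def
proof (intro conjI ballI allI impI)
  show "finite (f ` S)" "f ` S \<noteq> {}" using assms(1) by (auto simp: induces_cycle_def)
next
  fix x' assume "x' \<in> f ` S"
  then obtain x where x: "x \<in> S" "x' = f x" by blast
  obtain y y' where y: "y \<in> S" "y' \<in> S" "y \<noteq> y'" "\<And>z. z \<in> S \<Longrightarrow> E x z \<longleftrightarrow> z = y \<or> z = y'"
    using induces_cycle_nbrs[OF assms(1) x(1)] by blast
  show "\<exists>v\<in>f ` S. \<exists>v'\<in>f ` S. v \<noteq> v' \<and> (\<forall>z\<in>f ` S. E' x' z \<longleftrightarrow> z = v \<or> z = v')"
  proof (rule bexI[of _ "f y"], rule bexI[of _ "f y'"], intro conjI ballI)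
    show "f y \<noteq> f y'" using y assms(2) by (meson inj_onD)
    fix z' assume "z' \<in> f ` S"
    then obtain z where z: "z \<in> S" "z' = f z" by blast
    then show "E' x' z' \<longleftrightarrow> z' = f y \<or> z' = f y'"
      using E[OF x(1) z(1)] y x assms(2) by (metis inj_onD)
  qed (use y in auto)
next
  fix T assume T: "T \<inter> f ` S \<noteq> {}" "\<forall>x\<in>T \<inter> f ` S. \<forall>y\<in>f ` S. E' x y \<longrightarrow> y \<in> T"
  then obtain t where t: "t \<in> S" "f t \<in> T" by blast
  have "S \<subseteq> {x. f x \<in> T}"
    by (rule induces_cycle_connected[OF assms(1), of t]) (use t T E in auto)
  then show "f ` S \<subseteq> T" by auto
qed

lemma induced_cycle_vertex_set:
  assumes "has_induced_copy G (cycle_graph c)" "c \<ge> 3"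
  obtains S where "S \<subseteq> pverts G" "card S = c" "induces_cycle (\<lambda>u v. (u, v) \<in> parcs G) S"
proof -
  obtain f where "induced_embedding f (cycle_graph c) G" using assms(1) by (rule has_induced_copyE)
  then have f: "inj_on f {..<c}" "f ` {..<c} \<subseteq> pverts G"
    "\<And>u v. u \<in> {..<c} \<Longrightarrow> v \<in> {..<c} \<Longrightarrow> (u, v) \<in> parcs (cycle_graph c) \<longleftrightarrow> (f u, f v) \<in> parcs G"
    by (auto simp: induced_embedding_def)
  show thesis
    by (rule that[of "f ` {..<c}"])
      (use f card_image[OF f(1)] induces_cycle_image[OF induces_cycle_cycle_graph[OF assms(2)] f(1),
          of "\<lambda>u v. (u, v) \<in> parcs G"] in auto)
qed

lemma induced_cycle_of_cycle_graph:
  assumes "has_induced_copy (cycle_graph k) (cycle_graph c)" "c \<ge> 3"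
  shows "c = k"
proof -
  obtain S where S: "S \<subseteq> {..<k}" "card S = c"
    and cyc: "induces_cycle (\<lambda>u v. (u, v) \<in> parcs (cycle_graph k)) S"
    using induced_cycle_vertex_set[OF assms] by auto
  obtain x where x: "x \<in> S" using S(2) assms(2) by fastforce
  have "{..<k} \<subseteq> S"
  proof (rule succ_closed_subset[OF _ x])
    fix y assume y: "y \<in> S" "y < k"
    obtain z z' where z: "z \<in> S" "z' \<in> S" "z \<noteq> z'"
      "(y, z) \<in> parcs (cycle_graph k)" "(y, z') \<in> parcs (cycle_graph k)"
      using induces_cycle_nbrs[OF cyc y(1)] by metis
    then have "z < k" "z' < k" using S by auto
    \<comment> \<open>Predecessors are unique, so one of the two neighbours in \<open>S\<close> is
      the successor of \<open>y\<close>.\<close>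
    then have "\<not> (y = (z + 1) mod k \<and> y = (z' + 1) mod k)"
      using \<open>z \<noteq> z'\<close> succ_mod[of z k] succ_mod[of z' k] by (auto split: if_splits)
    then show "(y + 1) mod k \<in> S" using z by (auto simp: cycle_graph_arc_iff)
  qed (use x S in auto)
  then show ?thesis using S by (metis card_lessThan subset_antisym)
qed

text \<open>Connectedness confines the cycle to one copy, on which reduction modulo \<open>n\<close>
  is injective.\<close>

lemma induced_cycle_of_copies:
  assumes "has_induced_copy (copies m n E) (cycle_graph c)" "c \<ge> 3" "n > 0"
  obtains S where "S \<subseteq> {..<n}" "card S = c" "induces_cycle E S"
proof -
  obtain S where S: "S \<subseteq> pverts (copies m n E)" "card S = c"
    and cyc: "induces_cycle (\<lambda>u v. (u, v) \<in> parcs (copies m n E)) S"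
    using induced_cycle_vertex_set[OF assms(1,2)] by blast
  obtain x where x: "x \<in> S" using S(2) assms(2) by fastforce
  have "S \<subseteq> {y. y div n = x div n}"
    by (rule induces_cycle_connected[OF cyc _ x]) (auto simp: copies_def)
  then have same: "y div n = x div n" if "y \<in> S" for y using that by blast
  have inj: "inj_on (\<lambda>y. y mod n) S"
    by (rule inj_onI) (metis same div_mult_mod_eq)
  have "induces_cycle E ((\<lambda>y. y mod n) ` S)"
    by (rule induces_cycle_image[OF cyc inj]) (use S(1) same in \<open>auto simp: copies_def\<close>)
  moreover have "(\<lambda>y. y mod n) ` S \<subseteq> {..<n}" using assms(3) by auto
  ultimately show thesis using that card_image[OF inj] S(2) by simp
qed

text \<open>The least vertex of a cycle would need two larger neighbours, but a path offers only
  one.\<close>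

lemma path_acyclic: "\<not> induces_cycle path_adj S"
proof
  assume cyc: "induces_cycle path_adj S"
  then have S: "finite S" "S \<noteq> {}" by (auto simp: induces_cycle_def)
  obtain y y' where y: "y \<in> S" "y' \<in> S" "y \<noteq> y'" "path_adj (Min S) y" "path_adj (Min S) y'"
    using induces_cycle_nbrs[OF cyc Min_in[OF S]] by metis
  then have "Min S \<le> y" "Min S \<le> y'" using S by auto
  then show False using y by (auto simp: path_adj_def)
qed

section \<open>Dumbbells\<close>

text \<open>Two cycles of lengths \<open>k\<close> and \<open>k'\<close> joined by a path, encoded as the path \<open>0, \<dots>, n - 1\<close> with a
  chord at each end.\<close>
definition dumbbell_adj :: "nat \<Rightarrow> nat \<Rightarrow> nat \<Rightarrow> nat \<Rightarrow> nat \<Rightarrow> bool" where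
  "dumbbell_adj k k' n u v \<longleftrightarrow> path_adj u v \<or> u = 0 \<and> v + 1 = k \<or> v = 0 \<and> u + 1 = k \<or>
     u + k' = n \<and> v + 1 = n \<or> v + k' = n \<and> u + 1 = n"

text \<open>The least vertex of the cycle has two larger neighbours, which only \<open>0\<close> and
  \<open>n - k'\<close> have. Following vertices of degree two from there forces a whole end cycle
  into \<open>S\<close>.\<close>

lemma dumbbell_cycles:
  fixes k k' l :: nat
  defines "n \<equiv> k + k' + l"
  assumes k: "k \<ge> 4" "k' \<ge> 4" and S: "S \<subseteq> {..<n}" and cyc: "induces_cycle (dumbbell_adj k k' n) S"
  shows "card S = k \<or> card S = k'"
proof -
  have fin: "finite S" "S \<noteq> {}" using cyc by (auto simp: induces_cycle_def)
  define x where "x = Min S"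
  have x: "x \<in> S" "\<And>y. y \<in> S \<Longrightarrow> x \<le> y" using fin by (auto simp: x_def)
  \<comment> \<open>Away from the chord ends a vertex has only its two path neighbours, so a cycle
    through it uses both.\<close>
  have up: "i + 1 \<in> S" if i: "i \<in> S" "0 < i" "i + 1 \<noteq> k" "i + k' \<noteq> n" "i + 1 \<noteq> n" for i
  proof -
    obtain y y' where y: "y \<in> S" "y' \<in> S" "y \<noteq> y'" "dumbbell_adj k k' n i y" "dumbbell_adj k k' n i y'"
      using induces_cycle_nbrs[OF cyc i(1)] by metis
    then have "y = i + 1 \<or> y' = i + 1" using i by (auto simp: dumbbell_adj_def path_adj_def)
    then show ?thesis using y by auto
  qed
  obtain y y' where y: "y \<in> S" "y' \<in> S" "y \<noteq> y'" "dumbbell_adj k k' n x y" "dumbbell_adj k k' n x y'"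
    using induces_cycle_nbrs[OF cyc x(1)] by metis
  have ge: "x \<le> y" "x \<le> y'" using y x by auto
  have "x = 0 \<and> 1 \<in> S \<and> k - 1 \<in> S \<or> x + k' = n \<and> x + 1 \<in> S"
    using y ge k by (auto simp: dumbbell_adj_def path_adj_def n_def)
  then show ?thesis
  proof (elim disjE conjE)
    assume x0: "x = 0" "1 \<in> S" "k - 1 \<in> S"
    have "i + 1 < k \<longrightarrow> i + 1 \<in> S" for i
    proof (induction i)
      case (Suc i)
      then show ?case using up[of "i + 1"] by (auto simp: n_def)
    qed (use x0 in simp)
    then have sub: "{..<k} \<subseteq> S" using x0 x(1) by (metis add.commute add_0 lessThan_iff not0_implies_Suc plus_1_eq_Suc subsetI)
    obtain z z' where z: "\<And>v. v \<in> S \<Longrightarrow> dumbbell_adj k k' n (k - 1) v \<longleftrightarrow> v = z \<or> v = z'"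
      using induces_cycle_nbrs[OF cyc x0(3)] by metis
    have "0 \<in> S" "k - 2 \<in> S" using sub k by auto
    moreover have "dumbbell_adj k k' n (k - 1) 0" "dumbbell_adj k k' n (k - 1) (k - 2)"
      "dumbbell_adj k k' n (k - 1) k" using k by (auto simp: dumbbell_adj_def path_adj_def)
    moreover have "k - 2 \<noteq> 0" "k \<noteq> 0" "k \<noteq> k - 2" using k by auto
    \<comment> \<open>At \<open>k - 1\<close> the neighbours \<open>0\<close> and
      \<open>k - 2\<close> are already in \<open>S\<close>, which leaves no room for the third one,
      \<open>k\<close>; hence \<open>S\<close> cannot leave the first cycle.\<close>
    ultimately have kS: "k \<notin> S" using z by metis
    have "S \<subseteq> {..<k}"
    proof (rule induces_cycle_connected[OF cyc _ \<open>0 \<in> S\<close>])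
      fix u v assume "u \<in> {..<k}" "v \<in> S" "dumbbell_adj k k' n u v"
      moreover have "v \<noteq> k" using kS \<open>v \<in> S\<close> by auto
      ultimately show "v \<in> {..<k}" using k by (auto simp: dumbbell_adj_def path_adj_def n_def)
    qed (use k in auto)
    with sub show ?thesis by (metis card_lessThan subset_antisym)
  next
    assume xk: "x + k' = n" "x + 1 \<in> S"
    have "x + i + 1 < n \<longrightarrow> x + i + 1 \<in> S" for i
    proof (induction i)
      case (Suc i)
      then show ?case using up[of "x + i + 1"] xk k by (auto simp: n_def)
    qed (use xk in simp)
    then have "v \<in> S" if "v \<in> {x..<n}" for v
      using that x(1) by (cases "v = x") (auto dest!: less_imp_Suc_add le_neq_implies_less)
    moreover have "S \<subseteq> {x..<n}" using S x(2) by auto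
    ultimately have "S = {x..<n}" by blast
    then show ?thesis using xk(1) by (metis card_atLeastLessThan add_diff_cancel_left')
  qed
qed

text \<open>The closed walk that traverses the path from \<open>0\<close> to \<open>n - 1\<close>, takes the second chord to
  \<open>n - k'\<close>, goes back along the path to \<open>k - 1\<close> and closes up with the first chord.\<close>
definition dumbbell_walk :: "nat \<Rightarrow> nat \<Rightarrow> nat \<Rightarrow> nat" where
  "dumbbell_walk k' n t = (if t < n then t else 2 * n - k' - t)"

text \<open>To revisit a vertex, or to meet a neighbour other than the previous or next vertex, the
  walk must run around an end cycle, taking at least \<open>k - 1\<close> or \<open>k' - 1\<close>
  steps. Windows are too short for that.\<close>

lemma dumbbell_walk_window:
  fixes k k' l N x y d :: nat
  defines "n \<equiv> k + k' + l" and "q \<equiv> k + k' + 2 * l + 2"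
  defines "\<phi> \<equiv> dumbbell_walk k' n"
  assumes "N < k" "N < k'" "x < q" "0 < d" "d < N"
    and y: "y = (if x + d < q then x + d else x + d - q)"
  shows "\<phi> x \<noteq> \<phi> y \<and> (dumbbell_adj k k' n (\<phi> x) (\<phi> y) \<longleftrightarrow> d = 1)"
proof -
  have "y < q" using assms by (auto split: if_splits)
  \<comment> \<open>The return branch is written as a sum, with \<open>2 * n - k'\<close> expanded,
    to keep truncated subtraction away from \<open>linarith\<close>.\<close>
  have \<phi>: "t < n \<and> \<phi> t = t \<or> n \<le> t \<and> \<phi> t + t = k + k + k' + l + l" if "t < q" for t
    using that \<open>N < k\<close> by (auto simp: \<phi>_def dumbbell_walk_def n_def q_def)
  have y': "y = x + d \<and> x + d < q \<or> y + q = x + d \<and> q \<le> x + d" using y by auto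
  show ?thesis
  proof (intro conjI iffI)
    show "\<phi> x \<noteq> \<phi> y"
      using \<phi>[OF \<open>x < q\<close>] \<phi>[OF \<open>y < q\<close>] y' assms(4-8)
      unfolding n_def q_def by linarith
    show "dumbbell_adj k k' n (\<phi> x) (\<phi> y)" if "d = 1"
    proof -
      note facts = \<phi>[OF \<open>x < q\<close>] \<phi>[OF \<open>y < q\<close>] y' assms(4-6) that
      \<comment> \<open>The four kinds of steps: along the path, over the second chord, back along
        the path, over the first chord.\<close>
      consider "x + 1 < n" | "x + 1 = n" | "n \<le> x" "x + 1 < q" | "x + 1 = q"
        using \<open>x < q\<close> by linarith
      then show ?thesis
      proof cases
        case 1
        then have "\<phi> y = \<phi> x + 1" using facts unfolding n_def q_def by linarith
        then show ?thesis by (simp add: dumbbell_adj_def path_adj_def)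
      next
        case 2
        then have "\<phi> x + 1 = n" "\<phi> y + k' = n" using facts unfolding n_def q_def by linarith+
        then show ?thesis by (simp add: dumbbell_adj_def)
      next
        case 3
        then have "\<phi> x = \<phi> y + 1" using facts unfolding n_def q_def by linarith
        then show ?thesis by (simp add: dumbbell_adj_def path_adj_def)
      next
        case 4
        then have "\<phi> x + 1 = k" "\<phi> y = 0" using facts unfolding n_def q_def by linarith+
        then show ?thesis by (simp add: dumbbell_adj_def)
      qed
    qed
    show "d = 1" if "dumbbell_adj k k' n (\<phi> x) (\<phi> y)"
      using that \<phi>[OF \<open>x < q\<close>] \<phi>[OF \<open>y < q\<close>] y' assms(4-8)
      unfolding dumbbell_adj_def path_adj_def n_def q_def
      by (elim disjE conjE) linarith+
  qed
qed

lemma cycle_orientation_from_dumbbells: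
  fixes k k' l N :: nat
  assumes F: "\<And>H. H \<in> F \<Longrightarrow> oriented_graph H \<and> card (pverts H) \<le> N"
    and k: "N < k" "N < k'" "4 \<le> k" "4 \<le> k'"
    and orient: "\<And>m. \<exists>D. orientation_of D (copies m (k + k' + l) (dumbbell_adj k k' (k + k' + l))) \<and> free_of F D"
  shows "\<exists>D. orientation_of D (cycle_graph (k + k' + 2 * l + 2)) \<and> free_of F D"
proof -
  define n where "n = k + k' + l"
  define q where "q = k + k' + 2 * l + 2"
  define \<phi> where "\<phi> = dumbbell_walk k' n"
  define \<psi> where "\<psi> r s = \<phi> ((r + s) mod q)" for r s
  let ?E = "dumbbell_adj k k' n"
  have sym: "?E u v \<longleftrightarrow> ?E v u" for u v by (auto simp: dumbbell_adj_def path_adj_def)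
  have irr: "\<not> ?E u u" for u using k by (auto simp: dumbbell_adj_def path_adj_def)
  have lt: "\<psi> r s < n" for r s
    using k by (auto simp: \<psi>_def \<phi>_def dumbbell_walk_def n_def)
  have q: "N < q" "3 \<le> q" using k by (auto simp: q_def)
  have win: "\<psi> r s \<noteq> \<psi> r s' \<and> (?E (\<psi> r s) (\<psi> r s') \<longleftrightarrow> s' = s + 1)"
    if "s < s'" "s' < N" for r s s'
  proof -
    define x where "x = (r + s) mod q"
    have "x < q" using q by (simp add: x_def)
    have "(x + (s' - s)) mod q = (r + s + (s' - s)) mod q"
      unfolding x_def by (rule mod_add_left_eq)
    then have "(r + s') mod q = (x + (s' - s)) mod q" using that(1) by simp
    then have y: "(r + s') mod q = (if x + (s' - s) < q then x + (s' - s) else x + (s' - s) - q)"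
      using \<open>x < q\<close> that q by (auto simp: le_mod_geq)
    have "\<phi> x \<noteq> \<phi> ((r + s') mod q) \<and> (?E (\<phi> x) (\<phi> ((r + s') mod q)) \<longleftrightarrow> s' - s = 1)"
      unfolding \<phi>_def n_def
      by (rule dumbbell_walk_window[of N]) (use \<open>x < q\<close> y k that in \<open>auto simp: q_def\<close>)
    moreover have "s' - s = 1 \<longleftrightarrow> s' = s + 1" using that by auto
    ultimately show ?thesis by (simp add: \<psi>_def x_def)
  qed
  have win': "(\<psi> r s = \<psi> r s' \<longrightarrow> s = s') \<and> (?E (\<psi> r s) (\<psi> r s') \<longleftrightarrow> s' = s + 1 \<or> s = s' + 1)"
    if "s < N" "s' < N" for r s s'
  proof (cases s s' rule: linorder_cases)
    case less
    then show ?thesis using win[of s s' r] that by auto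
  next
    case equal
    then show ?thesis using irr by simp
  next
    case greater
    then show ?thesis using win[of s' s r] sym[of "\<psi> r s" "\<psi> r s'"] that by auto
  qed
  have suc: "(r + (s + 1)) mod q = ((r + s) mod q + 1) mod q" for r s
    by (simp add: mod_Suc_eq)
  \<comment> \<open>The predicate \<open>q' = q\<close> pins the length, since here the walk does
    not depend on the orientation.\<close>
  have "\<exists>q'. q' = q \<and> N < q' \<and> 3 \<le> q' \<and> (\<exists>D. orientation_of D (cycle_graph q') \<and> free_of F D)"
  proof (rule cycle_orientation_from_windows[where Q = q, OF _ _ F])
    show "\<exists>D. orientation_of D (copies m n ?E) \<and> free_of F D" for m
      using orient by (simp add: n_def)
    show "\<exists>q' w \<psi>. q' = q \<and> N < q' \<and> 3 \<le> q' \<and> q' \<le> q \<and>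
       (\<forall>r<q'. \<forall>s<N. \<psi> r s < n \<and>
          (\<forall>s'<N. (\<psi> r s = \<psi> r s' \<longrightarrow> s = s') \<and>
             (?E (\<psi> r s) (\<psi> r s') \<longleftrightarrow> s' = s + 1 \<or> s = s' + 1)) \<and>
          (s + 1 < N \<longrightarrow> (A (\<psi> r s) (\<psi> r (s + 1)) \<longleftrightarrow> w ((r + s) mod q'))))" for A
    \<comment> \<open>Bit \<open>t\<close> is the direction that \<open>A\<close> gives to step
      \<open>t\<close> of the closed walk.\<close>
    proof (intro exI[of _ q] exI[of _ "\<lambda>t. A (\<phi> t) (\<phi> ((t + 1) mod q))"] exI[of _ \<psi>] conjI allI impI)
      show "A (\<psi> r s) (\<psi> r (s + 1)) \<longleftrightarrow> A (\<phi> ((r + s) mod q)) (\<phi> (((r + s) mod q + 1) mod q))" for r s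
        unfolding \<psi>_def suc ..
    qed (use lt win' q in auto)
  qed (use k q in \<open>auto simp: n_def\<close>)
  then show ?thesis by (auto simp: q_def)
qed

section \<open>Hole-free classes and the cycle lengths they admit\<close>

lemma cycle_graph_without_holes_iff:
  assumes "k \<ge> 4"
  shows "cycle_graph k \<in> graphs_without_holes C \<longleftrightarrow> k \<notin> C"
proof -
  have wf: "pair_wf_digraph (cycle_graph k)" "pair_graph (cycle_graph k)"
    using pair_graph_cycle_graph[of k] pair_graph_wf assms by auto
  have "induced_embedding id (cycle_graph k) (cycle_graph k)" by (simp add: induced_embedding_def)
  then have "has_hole (cycle_graph k) k"
    using has_induced_copyI wf(1) assms by (auto simp: has_hole_def)
  moreover have "c = k" if "has_hole (cycle_graph k) c" for c
    using that induced_cycle_of_cycle_graph[of k c] by (simp add: has_hole_def)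
  ultimately show ?thesis using wf(2) by (auto simp: graphs_without_holes_def)
qed

lemma path_copies_without_holes: "copies m n path_adj \<in> graphs_without_holes C"
proof -
  have "\<not> has_hole (copies m n path_adj) c" for c
  proof
    assume hole: "has_hole (copies m n path_adj) c"
    then obtain f where f: "induced_embedding f (cycle_graph c) (copies m n path_adj)" and c: "c \<ge> 4"
      unfolding has_hole_def using has_induced_copyE by blast
    have "f 0 \<in> {..<m * n}" using f c by (force simp: induced_embedding_def copies_def)
    then have "n > 0" by (cases n) auto
    then show False
      using hole induced_cycle_of_copies[of m n path_adj c] path_acyclic by (auto simp: has_hole_def)
  qed
  moreover have "pair_graph (copies m n path_adj)"
    by (rule pair_graph_copies) (auto simp: path_adj_def symp_def irreflp_def)
  ultimately show ?thesis by (simp add: graphs_without_holes_def)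
qed

lemma dumbbell_copies_without_holes:
  assumes "4 \<le> k" "4 \<le> k'" "k \<notin> C" "k' \<notin> C"
  shows "copies m (k + k' + l) (dumbbell_adj k k' (k + k' + l)) \<in> graphs_without_holes C"
proof -
  let ?E = "dumbbell_adj k k' (k + k' + l)"
  have "c = k \<or> c = k'" if "has_hole (copies m (k + k' + l) ?E) c" for c
  proof -
    have "has_induced_copy (copies m (k + k' + l) ?E) (cycle_graph c)" "3 \<le> c" "0 < k + k' + l"
      using that assms(1) by (auto simp: has_hole_def)
    then obtain S where "S \<subseteq> {..<k + k' + l}" "card S = c" "induces_cycle ?E S"
      by (rule induced_cycle_of_copies)
    then show ?thesis using dumbbell_cycles[OF assms(1,2)] by blast
  qed
  moreover have "pair_graph (copies m (k + k' + l) ?E)"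
    by (rule pair_graph_copies)
      (use assms in \<open>auto simp: dumbbell_adj_def path_adj_def symp_def irreflp_def\<close>)
  ultimately show ?thesis using assms by (auto simp: graphs_without_holes_def)
qed

text \<open>Reduces the theorem to arithmetic: one length outside \<open>C\<close>, and a rule
  producing further ones from any two.\<close>

lemma expressible_cycle_lengths:
  assumes "expressible_by_forbidden_orientations (graphs_without_holes C)"
  obtains N k where "k > N" "k \<ge> 4" "k \<notin> C"
    "\<And>k k' l. \<lbrakk>N < k; N < k'; 4 \<le> k; 4 \<le> k'; k \<notin> C; k' \<notin> C\<rbrakk> \<Longrightarrow> k + k' + 2 * l + 2 \<notin> C"
proof -
  obtain F :: "nat pair_pre_digraph set" where F: "finite F" "\<And>H. H \<in> F \<Longrightarrow> oriented_graph H"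
    and ex: "\<And>G. pair_graph G \<Longrightarrow> G \<in> graphs_without_holes C \<longleftrightarrow> (\<exists>D. orientation_of D G \<and> free_of F D)"
    using assms unfolding expressible_by_forbidden_orientations_def by blast
  have ex': "\<exists>D. orientation_of D G \<and> free_of F D" if "G \<in> graphs_without_holes C" for G
    using ex[of G] that by (auto simp: graphs_without_holes_def)
  have cyc: "q \<notin> C" if "\<exists>D. orientation_of D (cycle_graph q) \<and> free_of F D" "4 \<le> q" for q
    using that ex[OF pair_graph_cycle_graph[of q]] cycle_graph_without_holes_iff[of q C] by simp
  \<comment> \<open>The inserted 3 keeps the set nonempty and turns \<open>N < q\<close> into
    \<open>4 \<le> q\<close>.\<close>
  define N where "N = Max (insert 3 ((\<lambda>H. card (pverts H)) ` F))"
  have N: "oriented_graph H \<and> card (pverts H) \<le> N" if "H \<in> F" for H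
    using F that by (auto simp: N_def intro!: Max_ge)
  have N3: "3 \<le> N" using F(1) by (auto simp: N_def intro!: Max_ge)
  obtain q where q: "N < q" "\<exists>D. orientation_of D (cycle_graph q) \<and> free_of F D"
    using large_cycle_orientation[OF N ex'[OF path_copies_without_holes]] by blast
  show thesis
  proof (rule that[of N q])
    show "q > N" "q \<ge> 4" "q \<notin> C" using q N3 cyc by auto
    fix k k' l assume k: "N < k" "N < k'" "4 \<le> k" "4 \<le> k'" "k \<notin> C" "k' \<notin> C"
    show "k + k' + 2 * l + 2 \<notin> C"
      by (rule cyc[OF cycle_orientation_from_dumbbells[OF N k(1-4) ex'[OF dumbbell_copies_without_holes[OF k(3-6)]]]])
        (use k in auto)
  qed
qed

theorem theorem17:
  fixes C :: "nat set"
  assumes "\<forall>c\<in>C. c > 0"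
  shows "(expressible_by_forbidden_orientations (graphs_without_holes C) \<longrightarrow>
            finite C \<or> (\<exists>M>0. from_on C M = {n. odd n \<and> n \<ge> M}))
       \<and> ((\<exists>M>0. from_on C M = {n. odd n \<and> n \<ge> M}) \<longleftrightarrow>
          (\<exists>M>0. from_on (cyc (graphs_without_holes C)) M = {n. even n \<and> n \<ge> M}))"
proof (intro conjI impI)
  assume "expressible_by_forbidden_orientations (graphs_without_holes C)"
  then obtain N k where k: "k > N" "k \<ge> 4" "k \<notin> C"
    and step: "\<And>k k' l. \<lbrakk>N < k; N < k'; 4 \<le> k; 4 \<le> k'; k \<notin> C; k' \<notin> C\<rbrakk> \<Longrightarrow> k + k' + 2 * l + 2 \<notin> C"
    by (rule expressible_cycle_lengths) blast
  \<comment> \<open>The least length that the rule yields from \<open>k\<close> and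
    \<open>k\<close>; all larger even lengths follow by varying \<open>l\<close>.\<close>
  define M where "M = 2 * k + 2"
  have even: "n \<notin> C" if "even n" "M \<le> n" for n
  proof -
    have "n = k + k + 2 * ((n - M) div 2) + 2" using that by (auto simp: M_def)
    then show ?thesis using step[OF k(1) k(1) k(2) k(2) k(3) k(3)] by metis
  qed
  show "finite C \<or> (\<exists>M>0. from_on C M = {n. odd n \<and> n \<ge> M})"
  proof (cases "\<exists>k'. odd k' \<and> M \<le> k' \<and> k' \<notin> C")
    case True
    then obtain k' where k': "odd k'" "M \<le> k'" "k' \<notin> C" by blast
    \<comment> \<open>\<open>M\<close> itself serves as the even length to be combined with the odd
      length \<open>k'\<close>.\<close>
    have kM: "N < M" "N < k'" "4 \<le> M" "4 \<le> k'" "M \<notin> C" "even M"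
      using k k' even[of M] by (auto simp: M_def)
    have "n \<notin> C" if "odd n" "M + k' + 2 \<le> n" for n
    proof -
      have "n = M + k' + 2 * ((n - (M + k' + 2)) div 2) + 2" using that k' kM(6) by auto
      then show ?thesis using step[OF kM(1-5) k'(3)] by metis
    qed
    with even have "C \<subseteq> {..<M + k' + 2}" by (metis add_leD1 lessThan_iff not_le subsetI)
    then show ?thesis using finite_subset by blast
  next
    case False
    then have "from_on C M = {n. odd n \<and> n \<ge> M}" using even by (auto simp: from_on_def)
    moreover have "M > 0" by (simp add: M_def)
    ultimately show ?thesis by blast
  qed
next
  \<comment> \<open>The bound 4 matters because a triangle is not a hole, so 3 says nothing about
    \<open>C\<close>; this explains the shifts to \<open>M + 4\<close> below.\<close>
  have cyc: "k \<in> cyc (graphs_without_holes C) \<longleftrightarrow> k \<notin> C" if "k \<ge> 4" for k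
    using that cycle_graph_without_holes_iff[OF that] by (simp add: cyc_def)
  show "(\<exists>M>0. from_on C M = {n. odd n \<and> n \<ge> M}) \<longleftrightarrow>
      (\<exists>M>0. from_on (cyc (graphs_without_holes C)) M = {n. even n \<and> n \<ge> M})" (is "?L \<longleftrightarrow> ?R")
  proof
    assume ?L
    then obtain M where M: "\<And>n. n \<ge> M \<Longrightarrow> n \<in> C \<longleftrightarrow> odd n" by (auto simp: from_on_def set_eq_iff)
    then have "from_on (cyc (graphs_without_holes C)) (M + 4) = {n. even n \<and> n \<ge> M + 4}"
      using cyc by (auto simp: from_on_def)
    then show ?R by (intro exI[of _ "M + 4"]) simp
  next
    assume ?R
    then obtain M where M: "\<And>n. n \<ge> M \<Longrightarrow> n \<in> cyc (graphs_without_holes C) \<longleftrightarrow> even n"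
      by (auto simp: from_on_def set_eq_iff)
    then have "n \<in> C \<longleftrightarrow> odd n" if "n \<ge> M + 4" for n using cyc[of n] M[of n] that by auto
    then have "from_on C (M + 4) = {n. odd n \<and> n \<ge> M + 4}" by (auto simp: from_on_def)
    then show ?L by (intro exI[of _ "M + 4"]) simp
  qed
qed

end
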